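(* Let $\gamma\in(1,2)$ and $\beta>0$ be fixed, assume the solution set $\Omega^*$ is nonempty, and let $\{(x^{k+1},\hat y^k,\hat\lambda^k,y^k,\lambda^k)\}_{k\ge 0}$ be generated by the over-relaxed ADMM described in the context from an arbitrary initial point $v^0=(y^0,\lambda^0)\in\mathbb{R}^{n_2}\times\mathbb{R}^m$. Write $v^k=(y^k,\lambda^k)$. If $$(\lambda^k-\hat\lambda^k)^T B(y^k-\hat y^k)\ge 0\quad\text{for every } k\ge 0,$$ then $$\lim_{k\to\infty}\left(\|B(y^k-y^{k+1})\|^2+\|\lambda^k-\lambda^{k+1}\|^2\right)=0,$$ and the sequence $\{v^k\}$ converges to a point $v^\infty\in\mathcal{V}^*$.
   Context: Problem: minimize $\theta_1(x)+\theta_2(y)$ subject to $Ax+By=b$, $x\in\mathcal{X}$, $y\in\mathcal{Y}$, where $\theta_1:\mathbb{R}^{n_1}\to\mathbb{R}$ and $\theta_2:\mathbb{R}^{n_2}\to\mathbb{R}$ are convex (not necessarily smooth), $A\in\mathbb{R}^{m\times n_1}$ and $B\in\mathbb{R}^{m\times n_2}$ have full column rank, $b\in\mathbb{R}^m$, and $\mathcal{X}\subset\mathbb{R}^{n_1}$, $\mathcal{Y}\subset\mathbb{R}^{n_2}$ are nonempty closed convex sets. $\|\cdot\|$ is the Euclidean norm. Solution sets: let $\Omega=\mathcal{X}\times\mathcal{Y}\times\mathbb{R}^m$ and, for $w=(x,y,\lambda)$, $u=(x,y)$, put $\theta(u)=\theta_1(x)+\theta_2(y)$ and $F(w)=(-A^T\lambda,\,-B^T\lambda,\,Ax+By-b)$.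 $\Omega^*$ is the set of $w^*=(x^*,y^*,\lambda^* )\in\Omega$ (with $u^*=(x^*,y^* )$) such that $\theta(u)-\theta(u^* )+(w-w^* )^TF(w^* )\ge0$ for all $w\in\Omega$; equivalently, the set of saddle points of the Lagrangian $\theta_1(x)+\theta_2(y)-\lambda^T(Ax+By-b)$ over $\Omega$. $\mathcal{V}^*=\{(y^*,\lambda^* ) : (x^*,y^*,\lambda^* )\in\Omega^* \text{ for some } x^*\}$. Over-relaxed ADMM with penalty parameter $\beta>0$ and relaxation factor $\gamma\in(1,2)$: given $(y^k,\lambda^k)$, compute $x^{k+1}=\arg\min_{x\in\mathcal{X}}\{\theta_1(x)-x^TA^T\lambda^k+\frac{\beta}{2}\|Ax+By^k-b\|^2\}$, $\hat y^k=\arg\min_{y\in\mathcal{Y}}\{\theta_2(y)-y^TB^T\lambda^k+\frac{\beta}{2}\|Ax^{k+1}+By-b\|^2\}$, $\hat\lambda^k=\lambda^k-\beta(Ax^{k+1}+B\hat y^k-b)$. If $(\lambda^k-\hat\lambda^k)^TB(y^k-\hat y^k)\ge0$, set $y^{k+1}=y^k-\gamma(y^k-\hat y^k)$ and $\lambda^{k+1}=\lambda^k-\gamma(\lambda^k-\hat\lambda^k)$; otherwise set $y^{k+1}=\hat y^k$ and $\lambda^{k+1}=\hat\lambda^k$. *)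

theory Defs
  imports "HOL-Analysis.Analysis"
begin

definition Omega :: "(real^'n1) set \<Rightarrow> (real^'n2) set \<Rightarrow> ((real^'n1) \<times> (real^'n2) \<times> (real^'m)) set"
  where "Omega X Y = X \<times> Y \<times> UNIV"

definition theta ::
  "(real^'n1 \<Rightarrow> real) \<Rightarrow> (real^'n2 \<Rightarrow> real) \<Rightarrow> (real^'n1) \<times> (real^'n2) \<Rightarrow> real"
  where "theta \<theta>1 \<theta>2 = (\<lambda>(x, y). \<theta>1 x + \<theta>2 y)"

definition F ::
  "real^'n1^'m \<Rightarrow> real^'n2^'m \<Rightarrow> real^'m
    \<Rightarrow> (real^'n1) \<times> (real^'n2) \<times> (real^'m) \<Rightarrow> (real^'n1) \<times> (real^'n2) \<times> (real^'m)"
  where "F A B b = (\<lambda>(x, y, l). (- (transpose A *v l), - (transpose B *v l), A *v x + B *v y - b))"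

definition Omega_star ::
  "(real^'n1 \<Rightarrow> real) \<Rightarrow> (real^'n2 \<Rightarrow> real) \<Rightarrow> real^'n1^'m \<Rightarrow> real^'n2^'m \<Rightarrow> real^'m
    \<Rightarrow> (real^'n1) set \<Rightarrow> (real^'n2) set \<Rightarrow> ((real^'n1) \<times> (real^'n2) \<times> (real^'m)) set"
  where "Omega_star \<theta>1 \<theta>2 A B b X Y =
    {(xs, ys, ls). (xs, ys, ls) \<in> Omega X Y \<and>
      (\<forall>(x, y, l) \<in> Omega X Y.
        theta \<theta>1 \<theta>2 (x, y) - theta \<theta>1 \<theta>2 (xs, ys)
          + ((x, y, l) - (xs, ys, ls)) \<bullet> F A B b (xs, ys, ls) \<ge> 0)}"

definition V_star ::
  "(real^'n1 \<Rightarrow> real) \<Rightarrow> (real^'n2 \<Rightarrow> real) \<Rightarrow> real^'n1^'m \<Rightarrow> real^'n2^'m \<Rightarrow> real^'m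
    \<Rightarrow> (real^'n1) set \<Rightarrow> (real^'n2) set \<Rightarrow> ((real^'n2) \<times> (real^'m)) set"
  where "V_star \<theta>1 \<theta>2 A B b X Y =
    {(ys, ls). \<exists>xs. (xs, ys, ls) \<in> Omega_star \<theta>1 \<theta>2 A B b X Y}"

text \<open>
  The iterates are given as sequences \<open>x\<close>, \<open>yh\<close>, \<open>lh\<close>, \<open>y\<close>, \<open>l\<close>, where \<open>yh\<close> and \<open>lh\<close> are the
  predictors of \<open>y\<close> and of the multiplier \<open>l\<close>. The entry \<open>x 0\<close> is unconstrained and never used,
  and \<open>y 0\<close>, \<open>l 0\<close> are arbitrary (in particular \<open>y 0\<close> need not lie in \<open>Y\<close>).
\<close>

definition over_relaxed_ADMM ::
  "(real^'n1 \<Rightarrow> real) \<Rightarrow> (real^'n2 \<Rightarrow> real) \<Rightarrow> real^'n1^'m \<Rightarrow> real^'n2^'m \<Rightarrow> real^'m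
    \<Rightarrow> (real^'n1) set \<Rightarrow> (real^'n2) set \<Rightarrow> real \<Rightarrow> real
    \<Rightarrow> (nat \<Rightarrow> real^'n1) \<Rightarrow> (nat \<Rightarrow> real^'n2) \<Rightarrow> (nat \<Rightarrow> real^'m)
    \<Rightarrow> (nat \<Rightarrow> real^'n2) \<Rightarrow> (nat \<Rightarrow> real^'m) \<Rightarrow> bool"
  where "over_relaxed_ADMM \<theta>1 \<theta>2 A B b X Y \<beta> \<gamma> x yh lh y l \<longleftrightarrow>
    (\<forall>k.
      is_arg_min
        (\<lambda>\<xi>. \<theta>1 \<xi> - \<xi> \<bullet> (transpose A *v l k) + \<beta> / 2 * (norm (A *v \<xi> + B *v y k - b))\<^sup>2)
        (\<lambda>\<xi>. \<xi> \<in> X) (x (Suc k)) \<and>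
      is_arg_min
        (\<lambda>\<eta>. \<theta>2 \<eta> - \<eta> \<bullet> (transpose B *v l k) + \<beta> / 2 * (norm (A *v x (Suc k) + B *v \<eta> - b))\<^sup>2)
        (\<lambda>\<eta>. \<eta> \<in> Y) (yh k) \<and>
      lh k = l k - \<beta> *\<^sub>R (A *v x (Suc k) + B *v yh k - b) \<and>
      (if (l k - lh k) \<bullet> (B *v (y k - yh k)) \<ge> 0
       then y (Suc k) = y k - \<gamma> *\<^sub>R (y k - yh k) \<and> l (Suc k) = l k - \<gamma> *\<^sub>R (l k - lh k)
       else y (Suc k) = yh k \<and> l (Suc k) = lh k))"

end

theory Submission
  imports Defs
begin

text \<open>
  The prediction step is a proximal-point-like step: in the scalar product
  \<open>\<beta> (B y) \<bullet> (B y') + (l \<bullet> l') / \<beta>\<close> the optimality conditions of the two subproblems and of a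
  solution \<open>v\<^sup>*\<close> combine to \<open>\<langle>vh - v\<^sup>*, v - vh\<rangle> \<ge> (l - lh) \<bullet> B (y - yh)\<close>, which is nonnegative
  by assumption. Hence relaxation with a factor in \<open>(0, 2)\<close> makes the iterates Fejer monotone
  with respect to the solution set, and \<open>v - vh\<close> tends to \<open>0\<close>. Passing to the limit in the
  optimality conditions shows that every cluster point is a solution, so the whole sequence converges.
\<close>

section \<open>Fejer monotone relaxed iterations\<close>

text \<open>The sign condition bounds the inner product of \<open>z - s\<close> and
  \<open>z - zh\<close> below by the squared norm of \<open>z - zh\<close>. In the expanded square
  the cross term therefore outweighs the quadratic term whenever 0 < \<gamma> < 2.\<close>

lemma Fejer_relaxation_step:
  fixes z zh s :: "'a::real_inner"
  assumes "(zh - s) \<bullet> (z - zh) \<ge> 0" and "\<gamma> \<ge> 0"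
  shows "(norm (z - \<gamma> *\<^sub>R (z - zh) - s))\<^sup>2
    \<le> (norm (z - s))\<^sup>2 - \<gamma> * (2 - \<gamma>) * (norm (z - zh))\<^sup>2"
proof -
  define d where "d = z - zh"
  define e where "e = z - s"
  have "zh - s = e - d" by (simp add: d_def e_def)
  then have "(e - d) \<bullet> d \<ge> 0" using assms(1) by (simp only: d_def[symmetric])
  then have le: "\<gamma> * (d \<bullet> d) \<le> \<gamma> * (e \<bullet> d)"
    using assms(2) by (intro mult_left_mono) (simp_all add: inner_diff_left)
  have "z - \<gamma> *\<^sub>R (z - zh) - s = e - \<gamma> *\<^sub>R d" by (simp add: d_def e_def)
  then have "(norm (z - \<gamma> *\<^sub>R (z - zh) - s))\<^sup>2 = (norm (e - \<gamma> *\<^sub>R d))\<^sup>2" by simp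
  also have "\<dots> = e \<bullet> e - 2 * (\<gamma> * (e \<bullet> d)) + \<gamma>\<^sup>2 * (d \<bullet> d)"
    unfolding power2_norm_eq_inner
    by (simp add: inner_diff_left inner_diff_right inner_commute[of d e] power2_eq_square algebra_simps)
  also have "\<dots> \<le> e \<bullet> e - 2 * (\<gamma> * (d \<bullet> d)) + \<gamma>\<^sup>2 * (d \<bullet> d)"
    using le by simp
  also have "\<dots> = (norm e)\<^sup>2 - \<gamma> * (2 - \<gamma>) * (norm d)\<^sup>2"
    unfolding power2_norm_eq_inner by (simp add: power2_eq_square algebra_simps)
  finally show ?thesis by (simp add: d_def e_def)
qed

text \<open>Squared distances to each point of \<open>S\<close> decrease, and the decrements
  dominate the residual \<open>z k - zh k\<close>, which hence vanishes; this is why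
  \<open>cluster\<close> may presuppose it. Boundedness then gives a cluster point in
  \<open>S\<close>, and the monotone distance to that point tends to 0 along a subsequence, so along
  the whole sequence.\<close>

lemma relaxed_iteration_tendsto:
  fixes z zh :: "nat \<Rightarrow> 'a::euclidean_space"
  assumes step: "\<And>k. z (Suc k) = z k - \<gamma> *\<^sub>R (z k - zh k)"
    and \<gamma>: "0 < \<gamma>" "\<gamma> < 2"
    and "S \<noteq> {}"
    and acute: "\<And>k s. s \<in> S \<Longrightarrow> (zh k - s) \<bullet> (z k - zh k) \<ge> 0"
    and cluster: "\<And>r s. (\<lambda>k. z k - zh k) \<longlonglongrightarrow> 0 \<Longrightarrow> strict_mono r \<Longrightarrow> (z \<circ> r) \<longlonglongrightarrow> s \<Longrightarrow> s \<in> S"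
  shows "\<exists>s\<in>S. z \<longlonglongrightarrow> s"
proof -
  define c where "c = \<gamma> * (2 - \<gamma>)"
  have c: "c > 0" using \<gamma> by (simp add: c_def)
  have descent: "c * (norm (z k - zh k))\<^sup>2 \<le> (norm (z k - s))\<^sup>2 - (norm (z (Suc k) - s))\<^sup>2"
    if "s \<in> S" for s k
    using Fejer_relaxation_step[OF acute[OF that, of k], of \<gamma>] \<gamma>(1) unfolding step c_def by linarith
  have dec: "decseq (\<lambda>k. (norm (z k - s))\<^sup>2)" if "s \<in> S" for s
  proof (rule decseq_SucI)
    fix k
    have "0 \<le> c * (norm (z k - zh k))\<^sup>2" using c by simp
    with descent[OF that, of k]
    show "(norm (z (Suc k) - s))\<^sup>2 \<le> (norm (z k - s))\<^sup>2" by linarith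
  qed
  obtain s0 where s0: "s0 \<in> S" using \<open>S \<noteq> {}\<close> by blast
  obtain L where L: "(\<lambda>k. (norm (z k - s0))\<^sup>2) \<longlonglongrightarrow> L"
    using decseq_convergent[OF dec[OF s0], of 0] by auto
  have "(\<lambda>k. (norm (z k - s0))\<^sup>2 - (norm (z (Suc k) - s0))\<^sup>2) \<longlonglongrightarrow> L - L"
    by (intro tendsto_diff L LIMSEQ_Suc)
  then have lim0: "(\<lambda>k. (norm (z k - s0))\<^sup>2 - (norm (z (Suc k) - s0))\<^sup>2) \<longlonglongrightarrow> 0" by simp
  have "(\<lambda>k. c * (norm (z k - zh k))\<^sup>2) \<longlonglongrightarrow> 0"
  proof (rule tendsto_sandwich[OF _ _ tendsto_const lim0])
    show "\<forall>\<^sub>F k in sequentially. 0 \<le> c * (norm (z k - zh k))\<^sup>2"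
      using c by simp
    show "\<forall>\<^sub>F k in sequentially. c * (norm (z k - zh k))\<^sup>2
        \<le> (norm (z k - s0))\<^sup>2 - (norm (z (Suc k) - s0))\<^sup>2"
      using descent[OF s0] by (intro always_eventually allI)
  qed
  then have "(\<lambda>k. inverse c * (c * (norm (z k - zh k))\<^sup>2)) \<longlonglongrightarrow> inverse c * 0"
    by (rule tendsto_mult_left)
  then have "(\<lambda>k. (norm (z k - zh k))\<^sup>2) \<longlonglongrightarrow> 0"
    using c by (simp add: mult.assoc[symmetric])
  then have "(\<lambda>k. sqrt ((norm (z k - zh k))\<^sup>2)) \<longlonglongrightarrow> sqrt 0"
    by (rule tendsto_real_sqrt)
  then have res: "(\<lambda>k. z k - zh k) \<longlonglongrightarrow> 0"
    by (simp add: tendsto_norm_zero_iff)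
  have "norm (z k - s0) \<le> norm (z 0 - s0)" for k
    using decseqD[OF dec[OF s0], of 0 k] by simp
  then have "range z \<subseteq> cball s0 (norm (z 0 - s0))"
    by (auto simp: dist_norm norm_minus_commute)
  then have "bounded (range z)" using bounded_subset bounded_cball by blast
  then obtain s r where r: "strict_mono (r :: nat \<Rightarrow> nat)" and zr: "(z \<circ> r) \<longlonglongrightarrow> s"
    using bounded_imp_convergent_subsequence by blast
  have s: "s \<in> S" by (rule cluster[OF res r zr])
  obtain M where M: "(\<lambda>k. (norm (z k - s))\<^sup>2) \<longlonglongrightarrow> M"
    using decseq_convergent[OF dec[OF s], of 0] by auto
  have "(\<lambda>k. (norm ((z \<circ> r) k - s))\<^sup>2) \<longlonglongrightarrow> (norm (s - s))\<^sup>2"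
    by (intro tendsto_intros zr)
  moreover have "(\<lambda>k. (norm ((z \<circ> r) k - s))\<^sup>2) \<longlonglongrightarrow> M"
    using LIMSEQ_subseq_LIMSEQ[OF M r] by (simp add: o_def)
  ultimately have "(norm (s - s))\<^sup>2 = M" by (rule LIMSEQ_unique)
  then have "M = 0" by simp
  with M have "(\<lambda>k. sqrt ((norm (z k - s))\<^sup>2)) \<longlonglongrightarrow> sqrt 0"
    by (intro tendsto_real_sqrt) simp
  then have "z \<longlonglongrightarrow> s"
    by (simp add: tendsto_norm_zero_iff flip: LIM_zero_iff[of z])
  with s show "\<exists>s\<in>S. z \<longlonglongrightarrow> s" by blast
qed

section \<open>First-order optimality and the solution set\<close>

lemma nonneg_if_linear_perturbation_nonneg:
  fixes D C :: real
  assumes "\<And>t. 0 < t \<Longrightarrow> t \<le> 1 \<Longrightarrow> 0 \<le> D + t * C"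
  shows "0 \<le> D"
proof (rule tendsto_lowerbound)
  have "((\<lambda>t. D + t * C) \<longlongrightarrow> D + 0 * C) (at_right 0)"
    by (intro tendsto_intros)
  then show "((\<lambda>t. D + t * C) \<longlongrightarrow> D) (at_right 0)" by simp
  show "\<forall>\<^sub>F t in at_right 0. 0 \<le> D + t * C"
    unfolding eventually_at_right_field by (rule exI[of _ 1]) (simp add: assms)
qed simp

lemma inner_vector_matrix_mult:
  fixes M :: "real^'n^'m"
  shows "v \<bullet> (q v* M) = (M *v v) \<bullet> q"
  using dot_lmul_matrix[of q M v] by (simp only: inner_commute[of v] inner_commute[of "M *v v"])

text \<open>Only the quadratic part is differentiated, so \<open>\<theta>\<close> may be nonsmooth:
  \<open>p\<close> is compared with points of the segment towards \<open>\<xi>\<close>, convexity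
  handles \<open>\<theta>\<close>, and the step length tends to 0. Both ADMM subproblems are
  instances.\<close>

lemma arg_min_convex_plus_quadratic:
  fixes \<theta> :: "real^'n \<Rightarrow> real" and M :: "real^'n^'m"
  assumes "convex_on UNIV \<theta>" and "convex C"
    and min: "is_arg_min
      (\<lambda>\<xi>. \<theta> \<xi> - \<xi> \<bullet> (transpose M *v q) + \<beta> / 2 * (norm (M *v \<xi> + c))\<^sup>2) (\<lambda>\<xi>. \<xi> \<in> C) p"
    and "\<xi> \<in> C"
  shows "\<theta> \<xi> - \<theta> p + (M *v \<xi> - M *v p) \<bullet> (\<beta> *\<^sub>R (M *v p + c) - q) \<ge> 0"
proof -
  define d where "d = M *v \<xi> - M *v p"
  define e where "e = M *v p + c"
  have p: "p \<in> C" using min by (simp add: is_arg_min_def)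
  have "0 \<le> \<theta> \<xi> - \<theta> p + d \<bullet> (\<beta> *\<^sub>R e - q) + t * (\<beta> / 2 * (d \<bullet> d))" if t: "0 < t" "t \<le> 1" for t
  proof -
    define \<eta> where "\<eta> = (1 - t) *\<^sub>R p + t *\<^sub>R \<xi>"
    have "\<eta> \<in> C" using assms(2) p \<open>\<xi> \<in> C\<close> t by (simp add: \<eta>_def convex_alt)
    have M\<eta>: "M *v \<eta> = M *v p + t *\<^sub>R d"
      by (simp add: \<eta>_def d_def matrix_vector_right_distrib matrix_vector_mult_scaleR
          matrix_vector_mult_diff_distrib scaleR_diff_left scaleR_diff_right)
    have "\<theta> \<eta> \<le> (1 - t) * \<theta> p + t * \<theta> \<xi>"
      using convex_onD[OF assms(1), of t p \<xi>] t by (simp add: \<eta>_def)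
    moreover have "\<theta> p - (M *v p) \<bullet> q + \<beta> / 2 * (norm e)\<^sup>2
        \<le> \<theta> \<eta> - (M *v \<eta>) \<bullet> q + \<beta> / 2 * (norm (M *v \<eta> + c))\<^sup>2"
      using min \<open>\<eta> \<in> C\<close>
      by (simp only: is_arg_min_linorder transpose_matrix_vector inner_vector_matrix_mult e_def)
    then have "\<theta> p - (M *v p) \<bullet> q + \<beta> / 2 * (norm e)\<^sup>2
        \<le> \<theta> \<eta> - (M *v p + t *\<^sub>R d) \<bullet> q + \<beta> / 2 * (norm (e + t *\<^sub>R d))\<^sup>2"
      by (simp only: M\<eta> e_def add_ac)
    moreover have "(norm (e + t *\<^sub>R d))\<^sup>2 = (norm e)\<^sup>2 + 2 * t * (d \<bullet> e) + t * t * (d \<bullet> d)"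
      by (simp add: power2_norm_eq_inner inner_add_left inner_add_right inner_commute algebra_simps)
    \<comment> \<open>The values at \<open>p\<close> cancel and leave a common factor
      \<open>t\<close>, which is positive and can be divided out. The square of the displacement
      keeps a further \<open>t\<close>, which disappears in the limit.\<close>
    ultimately have "0 \<le> t * (\<theta> \<xi> - \<theta> p + d \<bullet> (\<beta> *\<^sub>R e - q) + t * (\<beta> / 2 * (d \<bullet> d)))"
      by (simp add: inner_add_left inner_diff_right algebra_simps)
    then show ?thesis using t by (simp add: zero_le_mult_iff)
  qed
  then show ?thesis
    unfolding d_def[symmetric] e_def[symmetric] by (rule nonneg_if_linear_perturbation_nonneg)
qed

text \<open>Since \<open>l\<close> ranges over the whole space, the joint inequality forces the
  constraint to hold; freezing one primal variable at its solution value then separates the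
  rest.\<close>

lemma Omega_star_iff:
  fixes A :: "real^'n1^'m" and B :: "real^'n2^'m"
  shows "(xs, ys, ls) \<in> Omega_star \<theta>1 \<theta>2 A B b X Y \<longleftrightarrow>
    xs \<in> X \<and> ys \<in> Y \<and> A *v xs + B *v ys = b \<and>
    (\<forall>\<xi>\<in>X. \<theta>1 \<xi> - \<theta>1 xs - (A *v \<xi> - A *v xs) \<bullet> ls \<ge> 0) \<and>
    (\<forall>\<eta>\<in>Y. \<theta>2 \<eta> - \<theta>2 ys - (B *v \<eta> - B *v ys) \<bullet> ls \<ge> 0)"
    (is "?L \<longleftrightarrow> ?R")
proof -
  have L: "?L \<longleftrightarrow> xs \<in> X \<and> ys \<in> Y \<and>
    (\<forall>\<xi>\<in>X. \<forall>\<eta>\<in>Y. \<forall>l. (\<theta>1 \<xi> - \<theta>1 xs - (A *v \<xi> - A *v xs) \<bullet> ls)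
      + (\<theta>2 \<eta> - \<theta>2 ys - (B *v \<eta> - B *v ys) \<bullet> ls)
      + (l - ls) \<bullet> (A *v xs + B *v ys - b) \<ge> 0)"
    unfolding Omega_star_def Omega_def theta_def F_def
    by (auto simp: inner_vector_matrix_mult inner_diff_left inner_diff_right inner_add_right algebra_simps)
  show ?thesis
  proof
    assume ?L
    then have X: "xs \<in> X" and Y: "ys \<in> Y" and
      VI: "\<And>\<xi> \<eta> l. \<xi> \<in> X \<Longrightarrow> \<eta> \<in> Y \<Longrightarrow> (\<theta>1 \<xi> - \<theta>1 xs - (A *v \<xi> - A *v xs) \<bullet> ls)
      + (\<theta>2 \<eta> - \<theta>2 ys - (B *v \<eta> - B *v ys) \<bullet> ls)
      + (l - ls) \<bullet> (A *v xs + B *v ys - b) \<ge> 0"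
      by (simp_all add: L)
    define g where "g = A *v xs + B *v ys - b"
    \<comment> \<open>With both primal variables frozen, moving the multiplier by \<open>- g\<close>
      leaves only this term.\<close>
    have "- (g \<bullet> g) \<ge> 0"
      using VI[OF X Y, of "ls - g"] by (simp add: g_def[symmetric])
    then have "g = 0" by (metis inner_ge_zero inner_eq_zero_iff neg_0_le_iff_le order_antisym)
    then show ?R using X Y VI[OF _ Y, of _ ls] VI[OF X, of _ ls] by (simp add: g_def)
  next
    assume ?R
    then show ?L unfolding L by simp
  qed
qed

text \<open>A linear left inverse is continuous in finite dimension, so it carries convergence of
  images under \<open>M\<close> back to the arguments.\<close>

lemma full_column_rank_left_inverse:
  fixes M :: "real^'n^'m"
  assumes "rank M = CARD('n)"
  obtains g where "linear g" and "\<And>v. g (M *v v) = v"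
proof -
  have "inj ((*v) M)"
    using assms full_rank_injective[of M] by simp
  then obtain g where "linear g" "g \<circ> (*v) M = id"
    using linear_injective_left_inverse[OF matrix_vector_mul_linear] by blast
  then show thesis by (intro that[of g]) (auto simp: fun_eq_iff)
qed

theorem theorem3p1:
  fixes \<theta>1 :: "real^'n1 \<Rightarrow> real" and \<theta>2 :: "real^'n2 \<Rightarrow> real"
    and A :: "real^'n1^'m" and B :: "real^'n2^'m" and b :: "real^'m"
    and X :: "(real^'n1) set" and Y :: "(real^'n2) set"
    and \<beta> \<gamma> :: real
    and x :: "nat \<Rightarrow> real^'n1" and yh y :: "nat \<Rightarrow> real^'n2" and lh l :: "nat \<Rightarrow> real^'m"
  assumes "convex_on UNIV \<theta>1" and "convex_on UNIV \<theta>2"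
    and "rank A = CARD('n1)" and "rank B = CARD('n2)"
    and "X \<noteq> {}" and "closed X" and "convex X"
    and "Y \<noteq> {}" and "closed Y" and "convex Y"
    and "\<beta> > 0" and "1 < \<gamma>" and "\<gamma> < 2"
    and "Omega_star \<theta>1 \<theta>2 A B b X Y \<noteq> {}"
    and "over_relaxed_ADMM \<theta>1 \<theta>2 A B b X Y \<beta> \<gamma> x yh lh y l"
    and "\<And>k. (l k - lh k) \<bullet> (B *v (y k - yh k)) \<ge> 0"
  shows "((\<lambda>k. (norm (B *v (y k - y (Suc k))))\<^sup>2 + (norm (l k - l (Suc k)))\<^sup>2) \<longlonglongrightarrow> 0) \<and>
    (\<exists>v \<in> V_star \<theta>1 \<theta>2 A B b X Y. (\<lambda>k. (y k, l k)) \<longlonglongrightarrow> v)"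
proof -

  \<comment> \<open>Optimality conditions along the iteration\<close>
  note ADMM = assms(15)[unfolded over_relaxed_ADMM_def, rule_format]
  \<comment> \<open>The constants are regrouped to fit \<open>arg_min_convex_plus_quadratic\<close>,
    and the sign hypothesis selects the relaxed branch at every \<open>k\<close>.\<close>
  have xmin: "is_arg_min
      (\<lambda>\<xi>. \<theta>1 \<xi> - \<xi> \<bullet> (transpose A *v l k) + \<beta> / 2 * (norm (A *v \<xi> + (B *v y k - b)))\<^sup>2)
      (\<lambda>\<xi>. \<xi> \<in> X) (x (Suc k))"
    and ymin: "is_arg_min
      (\<lambda>\<eta>. \<theta>2 \<eta> - \<eta> \<bullet> (transpose B *v l k) + \<beta> / 2 * (norm (B *v \<eta> + (A *v x (Suc k) - b)))\<^sup>2)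
      (\<lambda>\<eta>. \<eta> \<in> Y) (yh k)"
    and lh: "lh k = l k - \<beta> *\<^sub>R (A *v x (Suc k) + B *v yh k - b)"
    and ystep: "y (Suc k) = y k - \<gamma> *\<^sub>R (y k - yh k)"
    and lstep: "l (Suc k) = l k - \<gamma> *\<^sub>R (l k - lh k)" for k
    using ADMM[of k] assms(16)[of k] by (simp_all add: algebra_simps)
  have xX: "x (Suc k) \<in> X" and yY: "yh k \<in> Y" for k
    using xmin[of k] ymin[of k] by (simp_all add: is_arg_min_def)
  \<comment> \<open>The \<open>y\<close>-subproblem produces exactly \<open>- lh k\<close>. The
    \<open>x\<close>-subproblem was solved with the old \<open>y k\<close>, so it carries the extra
    term in \<open>y k - yh k\<close>.\<close>
  have mults: "\<beta> *\<^sub>R (A *v x (Suc k) + (B *v y k - b)) - l k = \<beta> *\<^sub>R (B *v (y k - yh k)) - lh k"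
    "\<beta> *\<^sub>R (B *v yh k + (A *v x (Suc k) - b)) - l k = - lh k" for k
    by (simp_all add: lh matrix_vector_mult_diff_distrib algebra_simps)
  have xopt: "\<theta>1 \<xi> - \<theta>1 (x (Suc k))
      + (A *v \<xi> - A *v x (Suc k)) \<bullet> (\<beta> *\<^sub>R (B *v (y k - yh k)) - lh k) \<ge> 0" if "\<xi> \<in> X" for \<xi> k
    using arg_min_convex_plus_quadratic[OF assms(1,7) xmin that] by (simp only: mults)
  have yopt: "\<theta>2 \<eta> - \<theta>2 (yh k) + (B *v \<eta> - B *v yh k) \<bullet> (- lh k) \<ge> 0" if "\<eta> \<in> Y" for \<eta> k
    using arg_min_convex_plus_quadratic[OF assms(2,10) ymin that] by (simp only: mults)
  \<comment> \<open>The multiplier update solved for the image of \<open>x\<close>: it eliminates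
    \<open>x\<close> from the estimate below and later yields its limit.\<close>
  have residual: "A *v x (Suc k) = (1 / \<beta>) *\<^sub>R (l k - lh k) - B *v yh k + b" for k
    using \<open>\<beta> > 0\<close> by (simp add: lh)

  \<comment> \<open>\<open>T\<close> turns the weighted scalar product into the standard one, so that the convergence
    result for Euclidean spaces applies.\<close>
  define T where "T = (\<lambda>(u, v). (sqrt \<beta> *\<^sub>R (B *v u), (1 / sqrt \<beta>) *\<^sub>R v) :: (real^'m) \<times> (real^'m))"
  define z where "z = (\<lambda>k. T (y k, l k))"
  define zh where "zh = (\<lambda>k. T (yh k, lh k))"
  have T_diff: "T (u, v) - T (u', v') = T (u - u', v - v')" for u u' v v'
    by (simp add: T_def matrix_vector_mult_diff_distrib algebra_simps)
  have T_scale: "T (c *\<^sub>R u, c *\<^sub>R v) = c *\<^sub>R T (u, v)" for u v c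
    by (simp add: T_def matrix_vector_mult_scaleR)
  have T_inner: "T (u, v) \<bullet> T (u', v') = \<beta> * ((B *v u) \<bullet> (B *v u')) + (1 / \<beta>) * (v \<bullet> v')" for u u' v v'
    using \<open>\<beta> > 0\<close> by (simp add: T_def inner_prod_def field_simps)
  obtain gA where gA: "linear gA" "\<And>v. gA (A *v v) = v"
    using full_column_rank_left_inverse[OF assms(3)] by blast
  obtain gB where gB: "linear gB" "\<And>v. gB (B *v v) = v"
    using full_column_rank_left_inverse[OF assms(4)] by blast
  \<comment> \<open>A continuous left inverse of \<open>T\<close>, used to return from
    \<open>z\<close> to the original iterates.\<close>
  define G where "G = (\<lambda>(p, q). (gB ((1 / sqrt \<beta>) *\<^sub>R p), sqrt \<beta> *\<^sub>R q :: real^'m))"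
  have GT: "G (T w) = w" for w
    using \<open>\<beta> > 0\<close> by (cases w) (simp add: G_def T_def gB)
  have G_tendsto: "(\<lambda>k. G (f k)) \<longlonglongrightarrow> G p" if "f \<longlonglongrightarrow> p" for f p
    unfolding G_def case_prod_beta
    by (intro tendsto_intros bounded_linear.tendsto[OF linear_conv_bounded_linear[THEN iffD1, OF gB(1)]] that)
  have T_tendsto: "(\<lambda>k. T (f k)) \<longlonglongrightarrow> T p" if "f \<longlonglongrightarrow> p" for f p
    unfolding T_def case_prod_beta
    by (intro tendsto_intros bounded_linear.tendsto[OF matrix_vector_mul_bounded_linear] that)

  have zstep: "z (Suc k) = z k - \<gamma> *\<^sub>R (z k - zh k)" for k
    by (simp add: z_def zh_def T_diff ystep lstep flip: T_scale)
  have acute: "(zh k - s) \<bullet> (z k - zh k) \<ge> 0" if "s \<in> T ` V_star \<theta>1 \<theta>2 A B b X Y" for s k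
  proof -
    obtain xs ys ls where s: "s = T (ys, ls)" and "(xs, ys, ls) \<in> Omega_star \<theta>1 \<theta>2 A B b X Y"
      using \<open>s \<in> _\<close> by (auto simp: V_star_def)
    then have xs: "xs \<in> X" "ys \<in> Y" and feas: "A *v xs = b - B *v ys"
      and sx: "\<And>\<xi>. \<xi> \<in> X \<Longrightarrow> \<theta>1 \<xi> - \<theta>1 xs - (A *v \<xi> - A *v xs) \<bullet> ls \<ge> 0"
      and sy: "\<And>\<eta>. \<eta> \<in> Y \<Longrightarrow> \<theta>2 \<eta> - \<theta>2 ys - (B *v \<eta> - B *v ys) \<bullet> ls \<ge> 0"
      by (auto simp: Omega_star_iff algebra_simps)
    define d where "d = B *v (y k - yh k)"
    define e where "e = B *v (yh k - ys)"
    define dl where "dl = l k - lh k"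
    have x1: "A *v x (Suc k) - A *v xs = (1 / \<beta>) *\<^sub>R dl - e"
      by (simp add: residual feas e_def dl_def matrix_vector_mult_diff_distrib)
    then have x2: "A *v xs - A *v x (Suc k) = e - (1 / \<beta>) *\<^sub>R dl"
      by (simp add: algebra_simps)
    have y1: "B *v yh k - B *v ys = e" "B *v ys - B *v yh k = - e"
      by (simp_all add: e_def matrix_vector_mult_diff_distrib)
    \<comment> \<open>Sum of four inequalities: the subproblem conditions tested at the solution,
      and the solution conditions tested at \<open>x (Suc k)\<close> and \<open>yh k\<close>. All
      values of \<open>\<theta>1\<close> and \<open>\<theta>2\<close> cancel.\<close>
    have "0 \<le> (e - (1 / \<beta>) *\<^sub>R dl) \<bullet> (\<beta> *\<^sub>R d - lh k) - ((1 / \<beta>) *\<^sub>R dl - e) \<bullet> ls + e \<bullet> lh k - e \<bullet> ls"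
      using xopt[OF xs(1), of k] yopt[OF xs(2), of k] sx[OF xX, of k] sy[OF yY, of k]
      unfolding x1 x2 y1 d_def[symmetric] by simp
    \<comment> \<open>The leftover \<open>- (dl \<bullet> d)\<close> is nonpositive by the sign
      hypothesis, so dropping it preserves the lower bound 0.\<close>
    also have "\<dots> = \<beta> * (e \<bullet> d) + (1 / \<beta>) * ((lh k - ls) \<bullet> dl) - dl \<bullet> d"
      using \<open>\<beta> > 0\<close>
      by (simp add: inner_diff_left inner_diff_right inner_commute algebra_simps)
    finally have "0 \<le> \<beta> * (e \<bullet> d) + (1 / \<beta>) * ((lh k - ls) \<bullet> dl)"
      using assms(16)[of k] by (simp add: d_def dl_def)
    then show ?thesis
      by (simp add: z_def zh_def s T_diff T_inner e_def d_def dl_def)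
  qed
  have cluster: "s \<in> T ` V_star \<theta>1 \<theta>2 A B b X Y"
    if res: "(\<lambda>k. z k - zh k) \<longlonglongrightarrow> 0" and r: "strict_mono r" and zr: "(z \<circ> r) \<longlonglongrightarrow> s" for r s
  proof -
    have "((\<lambda>k. z k - zh k) \<circ> r) \<longlonglongrightarrow> 0"
      by (rule LIMSEQ_subseq_LIMSEQ[OF res r])
    from tendsto_diff[OF zr this] have zhr: "(\<lambda>k. zh (r k)) \<longlonglongrightarrow> s" by (simp add: o_def)
    obtain ys ls where Gs: "G s = (ys, ls)" by (cases "G s")
    have "(\<lambda>k. G (z (r k))) \<longlonglongrightarrow> G s" "(\<lambda>k. G (zh (r k))) \<longlonglongrightarrow> G s"
      using zr zhr by (auto intro!: G_tendsto simp: o_def)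
    then have yl: "(\<lambda>k. (y (r k), l (r k))) \<longlonglongrightarrow> (ys, ls)"
      and "(\<lambda>k. (yh (r k), lh (r k))) \<longlonglongrightarrow> (ys, ls)"
      by (simp_all add: z_def zh_def GT Gs)
    then have ly: "(\<lambda>k. y (r k)) \<longlonglongrightarrow> ys" "(\<lambda>k. l (r k)) \<longlonglongrightarrow> ls"
      "(\<lambda>k. yh (r k)) \<longlonglongrightarrow> ys" "(\<lambda>k. lh (r k)) \<longlonglongrightarrow> ls"
      by (auto dest: tendsto_fst tendsto_snd)
    \<comment> \<open>The limit \<open>s\<close> lives in the product space and has to be shown to
      lie in the range of \<open>T\<close>.\<close>
    have s: "s = T (ys, ls)"
      using LIMSEQ_unique[OF zr] T_tendsto[OF yl] by (simp add: z_def o_def)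
    note Mlim = bounded_linear.tendsto[OF matrix_vector_mul_bounded_linear]
    have "(\<lambda>k. (1 / \<beta>) *\<^sub>R (l (r k) - lh (r k)) - B *v yh (r k) + b)
        \<longlonglongrightarrow> (1 / \<beta>) *\<^sub>R (ls - ls) - B *v ys + b"
      by (intro tendsto_intros Mlim ly)
    then have Ax: "(\<lambda>k. A *v x (Suc (r k))) \<longlonglongrightarrow> b - B *v ys"
      by (simp add: residual)
    \<comment> \<open>No \<open>x\<close>-component is part of \<open>z\<close>; the limit of its
      image under \<open>A\<close> is known, and \<open>gA\<close> recovers the candidate from
      it.\<close>
    define xs where "xs = gA (b - B *v ys)"
    have "(\<lambda>k. gA (A *v x (Suc (r k)))) \<longlonglongrightarrow> xs" unfolding xs_def
      by (intro bounded_linear.tendsto[OF linear_conv_bounded_linear[THEN iffD1, OF gA(1)]] Ax)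
    then have lx: "(\<lambda>k. x (Suc (r k))) \<longlonglongrightarrow> xs" by (simp add: gA)
    have feas: "A *v xs + B *v ys = b"
      using LIMSEQ_unique[OF Ax Mlim[OF lx]] by (simp add: algebra_simps)
    have X: "xs \<in> X" using closed_sequentially[OF assms(6) _ lx] xX by simp
    \<comment> \<open>The predictors \<open>yh\<close> are used because the relaxed \<open>y\<close>
      may leave \<open>Y\<close>.\<close>
    have Y: "ys \<in> Y" using closed_sequentially[OF assms(9) _ ly(3)] yY by simp
    have "continuous_on UNIV \<theta>1" "continuous_on UNIV \<theta>2"
      using assms(1,2) by (auto intro: convex_on_continuous)
    then have lt: "(\<lambda>k. \<theta>1 (x (Suc (r k)))) \<longlonglongrightarrow> \<theta>1 xs" "(\<lambda>k. \<theta>2 (yh (r k))) \<longlonglongrightarrow> \<theta>2 ys"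
      using lx ly(3) by (auto intro: continuous_on_tendsto_compose)
    have "0 \<le> \<theta>1 \<xi> - \<theta>1 xs - (A *v \<xi> - A *v xs) \<bullet> ls" if "\<xi> \<in> X" for \<xi>
    proof -
      \<comment> \<open>The extra term of \<open>xopt\<close> vanishes in the limit, as
        \<open>y\<close> and \<open>yh\<close> share the limit \<open>ys\<close> along
        \<open>r\<close>.\<close>
      have "(\<lambda>k. \<theta>1 \<xi> - \<theta>1 (x (Suc (r k)))
        + (A *v \<xi> - A *v x (Suc (r k))) \<bullet> (\<beta> *\<^sub>R (B *v (y (r k) - yh (r k))) - lh (r k)))
        \<longlonglongrightarrow> \<theta>1 \<xi> - \<theta>1 xs + (A *v \<xi> - A *v xs) \<bullet> (\<beta> *\<^sub>R (B *v (ys - ys)) - ls)"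
        by (intro tendsto_intros lt ly lx Mlim)
      then show ?thesis using LIMSEQ_le_const[of _ _ 0] xopt[OF that] by fastforce
    qed
    moreover have "0 \<le> \<theta>2 \<eta> - \<theta>2 ys - (B *v \<eta> - B *v ys) \<bullet> ls" if "\<eta> \<in> Y" for \<eta>
    proof -
      have "(\<lambda>k. \<theta>2 \<eta> - \<theta>2 (yh (r k)) + (B *v \<eta> - B *v yh (r k)) \<bullet> (- lh (r k)))
        \<longlonglongrightarrow> \<theta>2 \<eta> - \<theta>2 ys + (B *v \<eta> - B *v ys) \<bullet> (- ls)"
        by (intro tendsto_intros lt ly Mlim)
      then show ?thesis using LIMSEQ_le_const[of _ _ 0] yopt[OF that] by fastforce
    qed
    ultimately have "(xs, ys, ls) \<in> Omega_star \<theta>1 \<theta>2 A B b X Y"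
      using X Y feas by (simp add: Omega_star_iff)
    then show ?thesis by (auto simp: s V_star_def)
  qed
  have "T ` V_star \<theta>1 \<theta>2 A B b X Y \<noteq> {}"
    using assms(14) by (auto simp: V_star_def)
  moreover have "0 < \<gamma>" using \<open>1 < \<gamma>\<close> by simp
  ultimately have "\<exists>s\<in>T ` V_star \<theta>1 \<theta>2 A B b X Y. z \<longlonglongrightarrow> s"
    using relaxed_iteration_tendsto[of z \<gamma> zh "T ` V_star \<theta>1 \<theta>2 A B b X Y"]
      zstep \<open>\<gamma> < 2\<close> acute cluster by blast
  then obtain v where v: "v \<in> V_star \<theta>1 \<theta>2 A B b X Y" and "z \<longlonglongrightarrow> T v" by blast
  then have "(\<lambda>k. G (z k)) \<longlonglongrightarrow> G (T v)" by (intro G_tendsto)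
  then have lim: "(\<lambda>k. (y k, l k)) \<longlonglongrightarrow> v" by (simp add: z_def GT)
  then have "y \<longlonglongrightarrow> fst v" "l \<longlonglongrightarrow> snd v"
    by (auto dest: tendsto_fst tendsto_snd)
  \<comment> \<open>The first claim follows from convergence itself: a sequence and its shift have
    the same limit.\<close>
  then have "(\<lambda>k. (norm (B *v (y k - y (Suc k))))\<^sup>2 + (norm (l k - l (Suc k)))\<^sup>2)
      \<longlonglongrightarrow> (norm (B *v (fst v - fst v)))\<^sup>2 + (norm (snd v - snd v))\<^sup>2"
    by (intro tendsto_intros bounded_linear.tendsto[OF matrix_vector_mul_bounded_linear] LIMSEQ_Suc)
  with v lim show ?thesis by auto
qed

end
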